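(* Let $G^*$ be a hypergraph of order $n$ with adjacency matrix $A$ and Seidel matrix $S$, and let $P_A(\lambda)=\det(\lambda I_n-A)$ and $P_S(\lambda)=\det(\lambda I_n-S)$ be their characteristic polynomials. Let $H_{G^*}$ be the walk generating function of $G^*$. Then $$P_S(\lambda)=(-2)^n\,P_A\!\left(-\frac{\lambda+1}{2}\right)\left(\frac{-1}{\lambda+1}\,H_{G^*}\!\left(\frac{-2}{\lambda+1}\right)+1\right).$$
   Context: A hypergraph $G^*=(V,E)$ of order $n$ has a finite vertex set $V=\{v_1,\dots,v_n\}$ and a finite set $E=\{e_1,\dots,e_m\}$ of hyperedges, each a subset of $V$. Its adjacency matrix $A=(a_{ij})$ is the $n\times n$ matrix with $a_{ij}=|\{e\in E:\{v_i,v_j\}\subset e\}|$ for $i\ne j$ and $a_{ii}=0$. Its Seidel matrix is $S=J_n-I_n-2A$, where $J_n$ is the all-ones matrix and $I_n$ the identity matrix of order $n$. A walk of length $l$ is a sequence $w_0,f_1,w_1,\dots,f_l,w_l$ with $w_i\in V$, $f_i\in E$, $w_{i-1}\neq w_i$ and $w_{i-1},w_i\in f_i$; $N_l$ denotes the total number of walks of length $l$ in $G^*$ (equivalently, the sum of all entries of $A^l$). The walk generating function is $H_{G^*}(t)=\sum_{l=0}^{\infty}N_l t^l$; this series converges for $|t|$ small and there equals a rational function of $t$, also denoted $H_{G^*}(t)$. The identity is understood as an identity of rational functions in $\lambda$ (equivalently, for all real $\lambda$ with $|\lambda+1|$ sufficiently large). *)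

theory Defs
  imports
    Complex_Main
    "HOL-Computational_Algebra.Fraction_Field"
    "Jordan_Normal_Form.Char_Poly"
begin

definition hypergraph :: "'a set \<Rightarrow> 'a set set \<Rightarrow> bool" where
  "hypergraph V E \<longleftrightarrow> finite V \<and> finite E \<and> (\<forall>e\<in>E. e \<subseteq> V)"

(* The vertices are enumerated as v 0, ..., v (n - 1). *)
definition adjacency_mat :: "nat \<Rightarrow> (nat \<Rightarrow> 'a) \<Rightarrow> 'a set set \<Rightarrow> real mat" where
  "adjacency_mat n v E =
     mat n n (\<lambda>(i, j). if i = j then 0 else real (card {e \<in> E. {v i, v j} \<subseteq> e}))"

definition seidel_mat :: "nat \<Rightarrow> (nat \<Rightarrow> 'a) \<Rightarrow> 'a set set \<Rightarrow> real mat" where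
  "seidel_mat n v E = mat n n (\<lambda>_. 1) - 1\<^sub>m n - 2 \<cdot>\<^sub>m adjacency_mat n v E"

(* A walk w_0, f_1, w_1, ..., f_l, w_l is encoded as the pair of lists
   [w_0, ..., w_l] and [f_1, ..., f_l]; hence f_(i+1) is fs ! i. *)
definition walks :: "'a set \<Rightarrow> 'a set set \<Rightarrow> nat \<Rightarrow> ('a list \<times> 'a set list) set" where
  "walks V E l =
     {(ws, fs). length ws = Suc l \<and> length fs = l \<and> set ws \<subseteq> V \<and> set fs \<subseteq> E \<and>
        (\<forall>i<l. ws ! i \<noteq> ws ! Suc i \<and> ws ! i \<in> fs ! i \<and> ws ! Suc i \<in> fs ! i)}"

definition num_walks :: "'a set \<Rightarrow> 'a set set \<Rightarrow> nat \<Rightarrow> nat" where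
  "num_walks V E l = card (walks V E l)"

(* Rational functions are elements of the fraction field of the polynomial ring.
   Such an h has a pole at t iff the denominator of every representation of h as a
   fraction vanishes at t; otherwise the value of h at t does not depend on the
   representation used, as long as its denominator does not vanish at t. *)
definition ratfun_pole :: "real poly fract \<Rightarrow> real \<Rightarrow> bool" where
  "ratfun_pole h t \<longleftrightarrow> (\<forall>p q. q \<noteq> 0 \<and> h = Fract p q \<longrightarrow> poly q t = 0)"

definition ratfun_eval :: "real poly fract \<Rightarrow> real \<Rightarrow> real" where
  "ratfun_eval h t =
     (THE y. \<exists>p q. h = Fract p q \<and> poly q t \<noteq> 0 \<and> y = poly p t / poly q t)"

definition is_ratfun_sum :: "(nat \<Rightarrow> real) \<Rightarrow> real poly fract \<Rightarrow> bool" where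
  "is_ratfun_sum a h \<longleftrightarrow>
     (\<forall>\<^sub>F t in nhds 0. \<not> ratfun_pole h t \<and> (\<lambda>l. a l * t ^ l) sums ratfun_eval h t)"

(* There is at most one such rational function, because two of them agree on a
   neighbourhood of 0; that there is one at all is asserted in the theorem. *)
definition walk_gen_fun :: "'a set \<Rightarrow> 'a set set \<Rightarrow> real poly fract" where
  "walk_gen_fun V E = (THE h. is_ratfun_sum (\<lambda>l. real (num_walks V E l)) h)"

end

theory Submission
  imports Defs
begin

text \<open>
  Near \<open>t = 0\<close> the vector \<open>y = (I - t A)\<inverse> 1\<close> is given by the Neumann series, whose coefficients
  count the walks by their first vertex, so \<open>H(t)\<close> is the sum of the entries of \<open>y\<close>. By the matrix
  determinant lemma \<open>det (I - t A + u J) = D(t) (1 + u H(t))\<close> with \<open>D(t) = det (I - t A)\<close>; taking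
  \<open>u = 1\<close> exhibits \<open>H = N / D\<close> with a polynomial \<open>N\<close>. The identity
  \<open>det (I - t A + u J) = D(t) + u N(t)\<close> is polynomial in \<open>t\<close>, so it extends from a
  neighbourhood of \<open>0\<close> to all \<open>t\<close>; the theorem is the case \<open>t = -2 / (x + 1)\<close>,
  \<open>u = -1 / (x + 1)\<close>, multiplied by \<open>(x + 1)\<^sup>n\<close>.
\<close>

section \<open>Rational functions\<close>

text \<open>A nonzero polynomial has finitely many roots, but every neighbourhood of 0 is infinite.
  This turns identities valid for small \<open>t\<close> into polynomial identities.\<close>

lemma poly_eq_0_if_eventually:
  fixes p :: "real poly"
  assumes "\<forall>\<^sub>F t in nhds 0. poly p t = 0"
  shows "p = 0"
proof (rule ccontr)
  assume "p \<noteq> 0"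
  then have fin: "finite {t. poly p t = 0}" by (rule poly_roots_finite)
  obtain d where d: "d > 0" "\<And>t. dist t 0 < d \<Longrightarrow> poly p t = 0"
    using assms unfolding eventually_nhds_metric by blast
  have "{0<..<d} \<subseteq> {t. poly p t = 0}" using d(2) by auto
  then have "finite {0<..<d}" using fin finite_subset by blast
  then show False using d(1) infinite_Ioo by blast
qed

lemma ratfun_eval_eq:
  assumes "h = Fract p q" "poly q t \<noteq> 0"
  shows "ratfun_eval h t = poly p t / poly q t"
  unfolding ratfun_eval_def
proof (rule the_equality)
  show "\<exists>p' q'. h = Fract p' q' \<and> poly q' t \<noteq> 0 \<and> poly p t / poly q t = poly p' t / poly q' t"
    using assms by blast
next
  fix y
  assume "\<exists>p' q'. h = Fract p' q' \<and> poly q' t \<noteq> 0 \<and> y = poly p' t / poly q' t"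
  then obtain p' q' where pq: "h = Fract p' q'" "poly q' t \<noteq> 0" "y = poly p' t / poly q' t"
    by blast
  have "q \<noteq> 0" "q' \<noteq> 0" using assms pq by auto
  then have "p * q' = p' * q" using assms(1) pq(1) by (simp add: eq_fract)
  then have "poly p t * poly q' t = poly p' t * poly q t" by (metis poly_mult)
  then show "y = poly p t / poly q t" using assms(2) pq(2,3) by (simp add: frac_eq_eq)
qed

lemma not_ratfun_pole:
  assumes "h = Fract p q" "poly q t \<noteq> 0"
  shows "\<not> ratfun_pole h t"
  using assms unfolding ratfun_pole_def by (metis poly_0)

text \<open>Cross-multiplication with a representation whose denominator does not vanish at
  \<open>t\<close>. Unlike \<open>ratfun_eval_eq\<close>, this covers \<open>poly q t = 0\<close>,
  where a common root of \<open>p\<close> and \<open>q\<close> cancels.\<close>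

lemma poly_numerator_eq:
  assumes "\<not> ratfun_pole h t" "h = Fract p q" "q \<noteq> 0"
  shows "poly p t = poly q t * ratfun_eval h t"
proof -
  obtain p' q' where pq: "q' \<noteq> 0" "h = Fract p' q'" "poly q' t \<noteq> 0"
    using assms(1) unfolding ratfun_pole_def by blast
  have "p * q' = p' * q" using assms pq by (simp add: eq_fract)
  then have "poly p t * poly q' t = poly p' t * poly q t" by (metis poly_mult)
  then have "poly p t = poly q t * (poly p' t / poly q' t)"
    using pq(3) by (simp add: eq_divide_eq mult.commute)
  then show ?thesis using ratfun_eval_eq[OF pq(2,3)] by simp
qed

text \<open>A series has only one sum, so both values agree near 0; the cross-multiplied difference
  is then a polynomial vanishing near 0. This justifies the \<open>THE\<close> in
  \<open>walk_gen_fun\<close>.\<close>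

lemma is_ratfun_sum_unique:
  assumes "is_ratfun_sum a h1" "is_ratfun_sum a h2"
  shows "h1 = h2"
proof -
  obtain p1 q1 where h1: "h1 = Fract p1 q1" "q1 \<noteq> 0" by (cases h1)
  obtain p2 q2 where h2: "h2 = Fract p2 q2" "q2 \<noteq> 0" by (cases h2)
  have "\<forall>\<^sub>F t in nhds 0. poly (p1 * q2 - p2 * q1) t = 0"
    using assms[unfolded is_ratfun_sum_def]
  proof eventually_elim
    case (elim t)
    have "ratfun_eval h1 t = ratfun_eval h2 t" using elim sums_unique2 by blast
    moreover have "poly p1 t = poly q1 t * ratfun_eval h1 t"
      using elim h1 by (intro poly_numerator_eq) auto
    moreover have "poly p2 t = poly q2 t * ratfun_eval h2 t"
      using elim h2 by (intro poly_numerator_eq) auto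
    ultimately show ?case by simp
  qed
  then have "p1 * q2 - p2 * q1 = 0" by (rule poly_eq_0_if_eventually)
  then show ?thesis using h1 h2 by (simp add: eq_fract)
qed

section \<open>Rank-one updates\<close>

text \<open>Stating the hypothesis as \<open>M y = c\<close> rather than through an inverse of \<open>M\<close> covers singular \<open>M\<close>
  as well. Both sides are the determinant of the block matrix with rows \<open>(M, -c)\<close> and
  \<open>(b, 1)\<close>, factored once with respect to each diagonal block.\<close>

lemma det_rank_one_update:
  fixes M :: "'a :: idom mat"
  assumes M: "M \<in> carrier_mat n n"
    and y: "\<And>i. i < n \<Longrightarrow> (\<Sum>j<n. M $$ (i, j) * y j) = c i"
  shows "det (mat n n (\<lambda>(i, j). M $$ (i, j) + c i * b j)) = det M * (1 + (\<Sum>j<n. b j * y j))"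
proof -
  define R where "R = mat 1 n (\<lambda>(_, j). b j)"
  define C where "C = mat n 1 (\<lambda>(i, _). - c i)"
  define Y where "Y = mat n 1 (\<lambda>(i, _). - y i)"
  define s where "s = mat 1 1 (\<lambda>_. 1 + (\<Sum>j<n. b j * y j))"
  define U where "U = mat n n (\<lambda>(i, j). M $$ (i, j) + c i * b j)"
  have carr: "R \<in> carrier_mat 1 n" "C \<in> carrier_mat n 1" "Y \<in> carrier_mat n 1"
    "s \<in> carrier_mat 1 1" "U \<in> carrier_mat n n"
    by (auto simp: R_def C_def Y_def s_def U_def)
  let ?K = "four_block_mat M C R (1\<^sub>m 1)"
  let ?L = "four_block_mat (1\<^sub>m n) (0\<^sub>m n 1) (- R) (1\<^sub>m 1)"
  have K: "?K \<in> carrier_mat (n + 1) (n + 1)" using M by auto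
  have L: "?L \<in> carrier_mat (n + 1) (n + 1)" by auto
  \<comment> \<open>Right multiplication by \<open>?L\<close> clears the lower left block and leaves
    the Schur complement \<open>M - C * R\<close>, which is \<open>U\<close>.\<close>
  have "?K * ?L = four_block_mat (M * 1\<^sub>m n + C * (- R)) (M * 0\<^sub>m n 1 + C * 1\<^sub>m 1)
      (R * 1\<^sub>m n + 1\<^sub>m 1 * (- R)) (R * 0\<^sub>m n 1 + 1\<^sub>m 1 * 1\<^sub>m 1)"
    using M carr by (intro mult_four_block_mat) auto
  also have "M * 1\<^sub>m n + C * (- R) = U"
    using M carr by (intro eq_matI) (auto simp: U_def C_def R_def scalar_prod_def)
  also have "M * 0\<^sub>m n 1 + C * 1\<^sub>m 1 = C" using M carr by auto
  also have "R * 1\<^sub>m n + 1\<^sub>m 1 * (- R) = 0\<^sub>m 1 n"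
    using carr by (intro eq_matI) auto
  also have "R * 0\<^sub>m n 1 + 1\<^sub>m 1 * 1\<^sub>m 1 = 1\<^sub>m 1" using carr by auto
  finally have "det (?K * ?L) = det U"
    using det_four_block_mat_lower_left_zero[OF carr(5) carr(2) refl one_carrier_mat] by simp
  moreover have "det (?K * ?L) = det ?K * det ?L" using K L by (rule det_mult)
  moreover have "det ?L = 1"
    using carr by (subst det_four_block_mat_upper_right_zero[of _ n _ 1]) auto
  ultimately have 1: "det ?K = det U" by simp
  let ?P = "four_block_mat M (0\<^sub>m n 1) R (1\<^sub>m 1)"
  let ?Q = "four_block_mat (1\<^sub>m n) Y (0\<^sub>m 1 n) s"
  have P: "?P \<in> carrier_mat (n + 1) (n + 1)" using M by auto
  have Q: "?Q \<in> carrier_mat (n + 1) (n + 1)" using carr by auto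
  \<comment> \<open>The hypothesis on \<open>y\<close> says \<open>M * Y = C\<close>, and
    \<open>s\<close> is chosen so that \<open>R * Y + s\<close> is 1; hence
    \<open>?K = ?P * ?Q\<close> without inverting \<open>M\<close>.\<close>
  have "?P * ?Q = four_block_mat (M * 1\<^sub>m n + 0\<^sub>m n 1 * 0\<^sub>m 1 n) (M * Y + 0\<^sub>m n 1 * s)
      (R * 1\<^sub>m n + 1\<^sub>m 1 * 0\<^sub>m 1 n) (R * Y + 1\<^sub>m 1 * s)"
    using M carr by (intro mult_four_block_mat) auto
  also have "M * 1\<^sub>m n + 0\<^sub>m n 1 * 0\<^sub>m 1 n = M" using M by auto
  also have "M * Y + 0\<^sub>m n 1 * s = C"
  proof (rule eq_matI)
    fix i j assume "i < dim_row C" "j < dim_col C"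
    then have "i < n" "j = 0" using carr by auto
    then show "(M * Y + 0\<^sub>m n 1 * s) $$ (i, j) = C $$ (i, j)"
      using M carr y[of i]
      by (simp add: C_def Y_def scalar_prod_def lessThan_atLeast0 sum_negf)
  qed (use M carr in auto)
  also have "R * 1\<^sub>m n + 1\<^sub>m 1 * 0\<^sub>m 1 n = R" using carr by auto
  also have "R * Y + 1\<^sub>m 1 * s = 1\<^sub>m 1"
    using carr by (intro eq_matI)
      (auto simp: R_def Y_def s_def scalar_prod_def lessThan_atLeast0 sum_negf)
  finally have "det ?K = det ?P * det ?Q" using det_mult[OF P Q] by simp
  moreover have "det ?P = det M"
    using M carr by (subst det_four_block_mat_upper_right_zero[of _ n _ 1]) auto
  moreover have "det ?Q = 1 + (\<Sum>j<n. b j * y j)"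
    using carr by (subst det_four_block_mat_lower_left_zero[of _ n _ 1])
      (auto simp: det_single s_def)
  ultimately show ?thesis using 1 by (simp add: U_def)
qed

section \<open>The Neumann series\<close>

text \<open>Entry \<open>i\<close> of \<open>A^l\<close> applied to the all-ones vector, in the
  recursive form that matches removing the first step of a walk.\<close>

fun walk_weight :: "nat \<Rightarrow> real mat \<Rightarrow> nat \<Rightarrow> nat \<Rightarrow> real" where
  "walk_weight n A 0 i = 1"
| "walk_weight n A (Suc l) i = (\<Sum>j<n. A $$ (i, j) * walk_weight n A l j)"

text \<open>A crude bound for all absolute row sums; the summand 1 keeps it positive even for
  \<open>A = 0\<close>, so that its reciprocal can serve as a radius.\<close>

definition neumann_bound :: "nat \<Rightarrow> real mat \<Rightarrow> real" where
  "neumann_bound n A = 1 + (\<Sum>i<n. \<Sum>j<n. \<bar>A $$ (i, j)\<bar>)"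

lemma neumann_bound_pos: "neumann_bound n A > 0"
  unfolding neumann_bound_def by (intro add_pos_nonneg sum_nonneg) auto

lemma walk_weight_bound:
  assumes "i < n"
  shows "\<bar>walk_weight n A l i\<bar> \<le> neumann_bound n A ^ l"
  using assms
proof (induction l arbitrary: i)
  case (Suc l)
  have "\<bar>walk_weight n A (Suc l) i\<bar> \<le> (\<Sum>j<n. \<bar>A $$ (i, j)\<bar> * neumann_bound n A ^ l)"
    unfolding walk_weight.simps
    by (rule order_trans[OF sum_abs]) (auto simp: abs_mult intro!: sum_mono mult_left_mono Suc.IH)
  also have "\<dots> = (\<Sum>j<n. \<bar>A $$ (i, j)\<bar>) * neumann_bound n A ^ l"
    by (simp add: sum_distrib_right)
  also have "\<dots> \<le> neumann_bound n A * neumann_bound n A ^ l"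
  proof (rule mult_right_mono)
    have "(\<Sum>j<n. \<bar>A $$ (i, j)\<bar>) \<le> (\<Sum>i<n. \<Sum>j<n. \<bar>A $$ (i, j)\<bar>)"
      using Suc.prems
      by (intro member_le_sum[where f = "\<lambda>i. \<Sum>j<n. \<bar>A $$ (i, j)\<bar>"]) (auto intro: sum_nonneg)
    then show "(\<Sum>j<n. \<bar>A $$ (i, j)\<bar>) \<le> neumann_bound n A" by (simp add: neumann_bound_def)
    show "0 \<le> neumann_bound n A ^ l" using neumann_bound_pos[of n A] by simp
  qed
  finally show ?case by simp
qed simp

lemma summable_walk_weight:
  assumes "i < n" "\<bar>t\<bar> * neumann_bound n A < 1"
  shows "summable (\<lambda>l. walk_weight n A l i * t ^ l)"
proof (rule summable_comparison_test')
  show "summable (\<lambda>l. (\<bar>t\<bar> * neumann_bound n A) ^ l)"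
    using assms(2) neumann_bound_pos[of n A] by (intro summable_geometric) (simp add: abs_mult)
  show "norm (walk_weight n A l i * t ^ l) \<le> (\<bar>t\<bar> * neumann_bound n A) ^ l" for l
    using mult_left_mono[OF walk_weight_bound[OF assms(1), of A l], of "\<bar>t\<bar> ^ l"]
    by (simp add: abs_mult power_abs power_mult_distrib mult.commute)
qed

text \<open>Split off the term \<open>l = 0\<close>, unfold the recursion and exchange the finite
  sum with the convergent series. In vector form this is \<open>(I - t A) y = 1\<close>.\<close>

lemma neumann_series_fixed_point:
  assumes "i < n" "\<bar>t\<bar> * neumann_bound n A < 1"
  shows "(\<Sum>l. walk_weight n A l i * t ^ l)
    = 1 + t * (\<Sum>j<n. A $$ (i, j) * (\<Sum>l. walk_weight n A l j * t ^ l))"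
proof -
  have "(\<Sum>l. walk_weight n A l i * t ^ l) = 1 + (\<Sum>l. walk_weight n A (Suc l) i * t ^ Suc l)"
    using suminf_split_head[OF summable_walk_weight[OF assms]] by simp
  also have "(\<lambda>l. walk_weight n A (Suc l) i * t ^ Suc l)
      = (\<lambda>l. \<Sum>j<n. t * A $$ (i, j) * (walk_weight n A l j * t ^ l))"
    by (simp add: fun_eq_iff sum_distrib_left sum_distrib_right mult_ac)
  also have "(\<Sum>l. \<Sum>j<n. t * A $$ (i, j) * (walk_weight n A l j * t ^ l))
      = (\<Sum>j<n. t * A $$ (i, j) * (\<Sum>l. walk_weight n A l j * t ^ l))"
    using assms(2)
    by (subst suminf_sum) (auto intro!: sum.cong suminf_mult summable_mult summable_walk_weight)
  finally show ?thesis by (simp add: sum_distrib_left mult_ac)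
qed

section \<open>The generating function as a quotient of determinants\<close>

text \<open>The matrix \<open>I + u J - t A\<close> with \<open>t\<close> as the polynomial
  variable, so that its determinant is a polynomial in \<open>t\<close>;
  \<open>resolvent_mat\<close> is its value at a real \<open>t\<close>.\<close>

definition resolvent_poly_mat :: "nat \<Rightarrow> real mat \<Rightarrow> real \<Rightarrow> real poly mat" where
  "resolvent_poly_mat n A u = mat n n (\<lambda>(i, j). [:(if i = j then 1 else 0) + u, - A $$ (i, j):])"

definition resolvent_mat :: "nat \<Rightarrow> real mat \<Rightarrow> real \<Rightarrow> real \<Rightarrow> real mat" where
  "resolvent_mat n A u t = mat n n (\<lambda>(i, j). (if i = j then 1 else 0) + u - t * A $$ (i, j))"

definition walk_denominator :: "nat \<Rightarrow> real mat \<Rightarrow> real poly" where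
  "walk_denominator n A = det (resolvent_poly_mat n A 0)"

definition walk_numerator :: "nat \<Rightarrow> real mat \<Rightarrow> real poly" where
  "walk_numerator n A = det (resolvent_poly_mat n A 1) - walk_denominator n A"

lemma poly_det_resolvent:
  "poly (det (resolvent_poly_mat n A u)) t = det (resolvent_mat n A u t)"
  by (rule poly_det_cong[of _ n]) (auto simp: resolvent_poly_mat_def resolvent_mat_def)

lemma eventually_small: "\<forall>\<^sub>F t in nhds 0. \<bar>t\<bar> * neumann_bound n A < 1"
  unfolding eventually_nhds_metric
  using neumann_bound_pos[of n A]
  by (intro exI[of _ "1 / neumann_bound n A"]) (auto simp: field_simps)

lemma det_resolvent_small:
  assumes "\<bar>t\<bar> * neumann_bound n A < 1"
  shows "det (resolvent_mat n A u t)
    = det (resolvent_mat n A 0 t) * (1 + u * (\<Sum>i<n. \<Sum>l. walk_weight n A l i * t ^ l))"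
proof -
  define y where "y i = (\<Sum>l. walk_weight n A l i * t ^ l)" for i
  have eq: "(\<Sum>j<n. resolvent_mat n A 0 t $$ (i, j) * y j) = 1" if "i < n" for i
  proof -
    have "(\<Sum>j<n. resolvent_mat n A 0 t $$ (i, j) * y j)
        = (\<Sum>j<n. (if j = i then y j else 0) - t * (A $$ (i, j) * y j))"
      using that by (intro sum.cong) (auto simp: resolvent_mat_def algebra_simps)
    also have "\<dots> = y i - t * (\<Sum>j<n. A $$ (i, j) * y j)"
      using that by (simp add: sum_subtractf sum_distrib_left)
    finally show ?thesis
      using neumann_series_fixed_point[OF that assms] by (simp add: y_def)
  qed
  \<comment> \<open>With \<open>c\<close> the all-ones vector and \<open>b\<close> constantly
    \<open>u\<close>, the rank-one term is \<open>u J\<close>.\<close>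
  have "resolvent_mat n A u t = mat n n (\<lambda>(i, j). resolvent_mat n A 0 t $$ (i, j) + 1 * u)"
    by (intro eq_matI) (auto simp: resolvent_mat_def)
  then show ?thesis
    using det_rank_one_update[where M = "resolvent_mat n A 0 t" and y = y and c = "\<lambda>_. 1"
        and b = "\<lambda>_. u" and n = n] eq
    by (simp add: resolvent_mat_def y_def sum_distrib_left)
qed

lemma det_resolvent:
  "det (resolvent_mat n A u t) = poly (walk_denominator n A) t + u * poly (walk_numerator n A) t"
proof -
  let ?p = "det (resolvent_poly_mat n A u) - walk_denominator n A - Polynomial.smult u (walk_numerator n A)"
  have "\<forall>\<^sub>F t in nhds 0. poly ?p t = 0"
    using eventually_small[of n A]
  proof eventually_elim
    case (elim t)
    \<comment> \<open>The instance 1 expresses the numerator through the series; inserting this into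
      the instance \<open>u\<close> eliminates the series.\<close>
    show ?case
      using det_resolvent_small[OF elim, of u] det_resolvent_small[OF elim, of 1]
      by (simp add: walk_numerator_def walk_denominator_def poly_det_resolvent algebra_simps)
  qed
  then have "?p = 0" by (rule poly_eq_0_if_eventually)
  then have "poly ?p t = 0" by simp
  then show ?thesis by (simp add: poly_det_resolvent)
qed

lemma walk_denominator_0: "poly (walk_denominator n A) 0 = 1"
proof -
  have "resolvent_mat n A 0 0 = 1\<^sub>m n" by (intro eq_matI) (auto simp: resolvent_mat_def)
  then show ?thesis by (simp add: walk_denominator_def poly_det_resolvent)
qed

lemma is_ratfun_sum_walk_weight:
  "is_ratfun_sum (\<lambda>l. \<Sum>i<n. walk_weight n A l i)
    (Fract (walk_numerator n A) (walk_denominator n A))"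
proof -
  \<comment> \<open>\<open>is_ratfun_sum\<close> also speaks of \<open>t = 0\<close> itself, so
    continuity is needed for the full filter \<open>nhds 0\<close>.\<close>
  have "(poly (walk_denominator n A) \<longlongrightarrow> poly (walk_denominator n A) 0) (nhds 0)"
    using poly_isCont[where p = "walk_denominator n A" and x = 0]
    by (simp only: isCont_def tendsto_at_iff_tendsto_nhds)
  then have "\<forall>\<^sub>F t in nhds 0. poly (walk_denominator n A) t \<noteq> 0"
    by (rule tendsto_imp_eventually_ne) (simp add: walk_denominator_0)
  then show ?thesis
    unfolding is_ratfun_sum_def using eventually_small[of n A]
  proof eventually_elim
    case (elim t)
    let ?s = "\<Sum>i<n. \<Sum>l. walk_weight n A l i * t ^ l"
    have "poly (walk_numerator n A) t = poly (walk_denominator n A) t * ?s"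
      using det_resolvent_small[OF elim(2), of 1]
      by (simp add: walk_numerator_def walk_denominator_def poly_det_resolvent algebra_simps)
    then have "ratfun_eval (Fract (walk_numerator n A) (walk_denominator n A)) t = ?s"
      using elim(1) by (simp add: ratfun_eval_eq)
    moreover have "(\<lambda>l. \<Sum>i<n. walk_weight n A l i * t ^ l) sums ?s"
      using elim(2) by (intro sums_sum summable_sums summable_walk_weight) auto
    ultimately show ?case
      using elim(1) not_ratfun_pole by (auto simp: sum_distrib_right)
  qed
qed

section \<open>Counting walks\<close>

definition walks_from :: "'a set \<Rightarrow> 'a set set \<Rightarrow> nat \<Rightarrow> 'a \<Rightarrow> ('a list \<times> 'a set list) set" where
  "walks_from V E l u = {p \<in> walks V E l. hd (fst p) = u}"

text \<open>The hyperedges leading from \<open>u\<close> to \<open>x\<close> in one step. The empty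
  case reflects both \<open>w_(i-1) \<noteq> w_i\<close> and the zero diagonal of the adjacency
  matrix.\<close>

definition walk_steps :: "'a set set \<Rightarrow> 'a \<Rightarrow> 'a \<Rightarrow> 'a set set" where
  "walk_steps E u x = (if u = x then {} else {e \<in> E. {u, x} \<subseteq> e})"

lemma finite_walks:
  assumes "finite V" "finite E"
  shows "finite (walks V E l)"
proof (rule finite_subset)
  show "walks V E l \<subseteq> {ws. set ws \<subseteq> V \<and> length ws = Suc l} \<times> {fs. set fs \<subseteq> E \<and> length fs = l}"
    by (auto simp: walks_def)
  show "finite ({ws. set ws \<subseteq> V \<and> length ws = Suc l} \<times> {fs. set fs \<subseteq> E \<and> length fs = l})"
    using assms by (intro finite_cartesian_product finite_lists_length_eq)
qed

lemma finite_walks_from: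
  assumes "finite V" "finite E"
  shows "finite (walks_from V E l u)"
  using finite_walks[OF assms] by (simp add: walks_from_def)

lemma walks_from_0: "u \<in> V \<Longrightarrow> walks_from V E 0 u = {([u], [])}"
  by (auto simp: walks_from_def walks_def length_Suc_conv)

text \<open>A walk decomposes into its first vertex, its first hyperedge and the remaining walk,
  which starts at a neighbour \<open>x\<close>.\<close>

lemma walks_from_Suc:
  assumes "u \<in> V"
  shows "walks_from V E (Suc l) u = (\<lambda>(f, ws, fs). (u # ws, f # fs)) `
    (\<Union>x\<in>V. walk_steps E u x \<times> walks_from V E l x)" (is "?L = ?R")
proof (intro subset_antisym subsetI)
  fix p assume "p \<in> ?L"
  then obtain x ws f fs where p: "p = (u # x # ws, f # fs)"
    and w: "(u # x # ws, f # fs) \<in> walks V E (Suc l)"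
    by (cases p) (auto simp: walks_from_def walks_def length_Suc_conv)
  have "(x # ws, fs) \<in> walks V E l" "f \<in> walk_steps E u x" "x \<in> V"
    using w by (auto simp: walks_def walk_steps_def All_less_Suc2)
  then have "(f, x # ws, fs) \<in> (\<Union>x\<in>V. walk_steps E u x \<times> walks_from V E l x)"
    by (auto simp: walks_from_def)
  then show "p \<in> ?R" unfolding p by (force intro: rev_image_eqI)
next
  fix p assume "p \<in> ?R"
  then obtain x f ws fs where p: "p = (u # ws, f # fs)" and x: "x \<in> V"
    and f: "f \<in> walk_steps E u x" and w: "(ws, fs) \<in> walks_from V E l x"
    by auto
  then have "ws \<noteq> []" by (auto simp: walks_from_def walks_def)
  then have "ws ! 0 = x" using w by (simp add: walks_from_def hd_conv_nth)
  then show "p \<in> ?L"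
    using assms f w by (auto simp: p walks_from_def walks_def walk_steps_def All_less_Suc2
        split: if_splits)
qed

lemma card_walks_from_Suc:
  assumes "finite V" "finite E" "u \<in> V"
  shows "card (walks_from V E (Suc l) u) = (\<Sum>x\<in>V. card (walk_steps E u x) * card (walks_from V E l x))"
proof -
  have fin: "finite (walk_steps E u x)" for x using assms(2) by (simp add: walk_steps_def)
  have "card (walks_from V E (Suc l) u) = card (\<Union>x\<in>V. walk_steps E u x \<times> walks_from V E l x)"
    unfolding walks_from_Suc[OF assms(3)] by (rule card_image) (auto simp: inj_on_def)
  \<comment> \<open>The pieces are disjoint because \<open>x\<close> is the head of the remaining
    walk.\<close>
  also have "\<dots> = (\<Sum>x\<in>V. card (walk_steps E u x \<times> walks_from V E l x))"
    using assms fin finite_walks_from[OF assms(1,2)]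
    by (intro card_UN_disjoint) (auto simp: walks_from_def)
  finally show ?thesis by (simp add: card_cartesian_product)
qed

lemma card_walks_from:
  assumes fin: "finite V" "finite E" and v: "bij_betw v {..<n} V" and i: "i < n"
  shows "real (card (walks_from V E l (v i))) = walk_weight n (adjacency_mat n v E) l i"
  using i
proof (induction l arbitrary: i)
  case 0
  then have "v i \<in> V" using v by (auto simp: bij_betw_def)
  then show ?case by (simp add: walks_from_0)
next
  case (Suc l)
  have vi: "v i \<in> V" using v Suc.prems by (auto simp: bij_betw_def)
  have "card (walks_from V E (Suc l) (v i))
      = (\<Sum>j<n. card (walk_steps E (v i) (v j)) * card (walks_from V E l (v j)))"
    unfolding card_walks_from_Suc[OF fin vi] by (rule sum.reindex_bij_betw[OF v, symmetric])
  also have "real \<dots> = (\<Sum>j<n. adjacency_mat n v E $$ (i, j)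
      * walk_weight n (adjacency_mat n v E) l j)"
    unfolding of_nat_sum of_nat_mult
  proof (rule sum.cong[OF refl])
    fix j assume "j \<in> {..<n}"
    \<comment> \<open>Injectivity of \<open>v\<close> matches the equality test on vertices in
      \<open>walk_steps\<close> with the one on indices in \<open>adjacency_mat\<close>.\<close>
    moreover have "v i = v j \<longleftrightarrow> i = j"
      using v Suc.prems calculation by (auto simp: bij_betw_def inj_on_def)
    ultimately show "real (card (walk_steps E (v i) (v j))) * real (card (walks_from V E l (v j)))
        = adjacency_mat n v E $$ (i, j) * walk_weight n (adjacency_mat n v E) l j"
      using Suc by (simp add: adjacency_mat_def walk_steps_def)
  qed
  finally show ?case by simp
qed

lemma num_walks_eq:
  assumes fin: "finite V" "finite E" and v: "bij_betw v {..<n} V"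
  shows "real (num_walks V E l) = (\<Sum>i<n. walk_weight n (adjacency_mat n v E) l i)"
proof -
  have "walks V E l = (\<Union>u\<in>V. walks_from V E l u)"
    by (auto simp: walks_from_def walks_def length_Suc_conv)
  moreover have "card (\<Union>u\<in>V. walks_from V E l u) = (\<Sum>u\<in>V. card (walks_from V E l u))"
    using fin finite_walks_from[OF fin]
    by (intro card_UN_disjoint) (auto simp: walks_from_def)
  ultimately have "num_walks V E l = (\<Sum>u\<in>V. card (walks_from V E l u))"
    by (simp add: num_walks_def)
  also have "\<dots> = (\<Sum>i<n. card (walks_from V E l (v i)))"
    by (rule sum.reindex_bij_betw[OF v, symmetric])
  finally show ?thesis using card_walks_from[OF fin v] by simp
qed

section \<open>Characteristic polynomials\<close>

text \<open>The hypothesis says \<open>x I - B = k M\<close> entrywise, and the determinant releases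
  one factor \<open>k\<close> per row. It serves both characteristic polynomials, with
  \<open>k = x + 1\<close> and \<open>k = -(x + 1) / 2\<close>.\<close>

lemma poly_char_poly_smult:
  fixes B M :: "real mat"
  assumes "B \<in> carrier_mat n n" "M \<in> carrier_mat n n"
    and "\<And>i j. i < n \<Longrightarrow> j < n \<Longrightarrow> (if i = j then x else 0) - B $$ (i, j) = k * M $$ (i, j)"
  shows "poly (char_poly B) x = k ^ n * det M"
proof -
  have "poly (char_poly B) x = det (k \<cdot>\<^sub>m M)"
    unfolding char_poly_def
  proof (rule poly_det_cong[of _ n])
    fix i j assume ij: "i < n" "j < n"
    show "poly (char_poly_matrix B $$ (i, j)) x = (k \<cdot>\<^sub>m M) $$ (i, j)"
      using assms(3)[OF ij] assms(1,2) ij by (auto simp: char_poly_matrix_def)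
  qed (use assms in auto)
  then show ?thesis using assms(2) by simp
qed

theorem theorem3p1:
  fixes V :: "'a set" and E :: "'a set set" and n :: nat and v :: "nat \<Rightarrow> 'a"
  assumes "hypergraph V E"
    and "bij_betw v {..<n} V"
  shows "is_ratfun_sum (\<lambda>l. real (num_walks V E l)) (walk_gen_fun V E) \<and>
    (\<forall>x :: real. x \<noteq> -1 \<and> \<not> ratfun_pole (walk_gen_fun V E) (-2 / (x + 1)) \<longrightarrow>
      poly (char_poly (seidel_mat n v E)) x =
        (-2) ^ n * poly (char_poly (adjacency_mat n v E)) (- ((x + 1) / 2)) *
          (-1 / (x + 1) * ratfun_eval (walk_gen_fun V E) (-2 / (x + 1)) + 1))"
proof -
  define A where "A = adjacency_mat n v E"
  define N where "N = walk_numerator n A"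
  define D where "D = walk_denominator n A"
  have A: "A \<in> carrier_mat n n" by (simp add: A_def adjacency_mat_def)
  have fin: "finite V" "finite E" using assms(1) by (auto simp: hypergraph_def)
  have sum: "is_ratfun_sum (\<lambda>l. real (num_walks V E l)) (Fract N D)"
    using is_ratfun_sum_walk_weight[of n A]
    by (simp add: num_walks_eq[OF fin assms(2)] A_def N_def D_def)
  then have h: "walk_gen_fun V E = Fract N D"
    unfolding walk_gen_fun_def using is_ratfun_sum_unique by (blast intro: the_equality)
  have D0: "D \<noteq> 0" using walk_denominator_0[of n A] by (auto simp: D_def)
  have "poly (char_poly (seidel_mat n v E)) x =
        (-2) ^ n * poly (char_poly A) (- ((x + 1) / 2)) *
          (-1 / (x + 1) * ratfun_eval (Fract N D) (-2 / (x + 1)) + 1)"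
    if x: "x \<noteq> -1" and pole: "\<not> ratfun_pole (Fract N D) (-2 / (x + 1))" for x
  proof -
    define t where "t = -2 / (x + 1)"
    have x1: "x + 1 \<noteq> 0" using x by simp
    \<comment> \<open>Here \<open>x I - S = (x + 1) I - J + 2 A\<close>; taking out
      \<open>x + 1\<close> dictates the values of \<open>u\<close> and \<open>t\<close>.\<close>
    have "(if i = j then x else 0) - seidel_mat n v E $$ (i, j)
        = (x + 1) * resolvent_mat n A (-1 / (x + 1)) t $$ (i, j)" if "i < n" "j < n" for i j
    proof -
      have "(x + 1) * (d + -1 / (x + 1) - t * a) = (x + 1) * d - 1 + 2 * a" for d a
      proof -
        have "(x + 1) * (d + -1 / (x + 1) - t * a)
            = (x + 1) * d + (x + 1) * (-1 / (x + 1)) - (x + 1) * t * a"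
          by (simp only: ring_distribs mult.assoc)
        moreover have "(x + 1) * t = -2" "(x + 1) * (-1 / (x + 1)) = -1"
          using x1 by (simp_all add: t_def divide_eq_eq)
        ultimately show ?thesis by (simp only:)
      qed
      then show ?thesis
        using that A by (simp add: seidel_mat_def A_def[symmetric] resolvent_mat_def)
    qed
    then have "poly (char_poly (seidel_mat n v E)) x
        = (x + 1) ^ n * det (resolvent_mat n A (-1 / (x + 1)) t)"
      by (intro poly_char_poly_smult)
        (auto simp: seidel_mat_def adjacency_mat_def resolvent_mat_def)
    also have "\<dots> = (x + 1) ^ n * (poly D t + (-1 / (x + 1)) * poly N t)"
      unfolding det_resolvent N_def D_def ..
    \<comment> \<open>\<open>D\<close> may vanish at \<open>t\<close> although the quotient has no
      pole there, so division by \<open>poly D t\<close> is avoided.\<close>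
    also have "poly N t = poly D t * ratfun_eval (Fract N D) t"
      using pole D0 by (intro poly_numerator_eq) (auto simp: t_def)
    also have "(x + 1) ^ n * (poly D t + (-1 / (x + 1)) * (poly D t * ratfun_eval (Fract N D) t))
        = (x + 1) ^ n * poly D t * (-1 / (x + 1) * ratfun_eval (Fract N D) t + 1)"
      by (simp add: algebra_simps)
    also have "(x + 1) ^ n * poly D t = (-2) ^ n * poly (char_poly A) (- ((x + 1) / 2))"
    proof -
      \<comment> \<open>For \<open>k = -(x + 1) / 2\<close> one has \<open>k t = 1\<close>, hence
        \<open>k I - A = k (I - t A)\<close>.\<close>
      have "poly (char_poly A) (- ((x + 1) / 2))
          = (- ((x + 1) / 2)) ^ n * det (resolvent_mat n A 0 t)"
        using A x1
        by (intro poly_char_poly_smult) (auto simp: resolvent_mat_def t_def field_simps)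
      moreover have "det (resolvent_mat n A 0 t) = poly D t"
        by (simp add: det_resolvent D_def)
      moreover have "(-2) ^ n * (- ((x + 1) / 2)) ^ n = (x + 1) ^ n"
        unfolding power_mult_distrib[symmetric]
        by (intro arg_cong[of _ _ "\<lambda>y. y ^ n"]) (simp add: field_simps)
      ultimately show ?thesis by (simp flip: mult.assoc)
    qed
    finally show ?thesis by (simp add: t_def)
  qed
  then show ?thesis using sum by (simp add: h A_def)
qed

end
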